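(* Let $X$ be a nonvoid set, let $(Y,\leq)$ be a nonvoid poset, and let $T : X \to Y$ be any mapping. Let $(X_T,\leq_T)$ be the quotient of $X$ by the relation $T(u)=T(v)$, with the pull-back partial order, and assume that neither $(Y,\leq)$ nor $(X_T,\leq_T)$ has a minimum or a maximum element. Let $X_T^{\#}$ and $Y^{\#}$ be the order completions (by cuts) of $X_T$ and $Y$, and let $T^{\#} : X_T^{\#} \to Y^{\#}$ be the extension of the induced injective mapping $T_\approx : X_T \to Y$. Let $F \in Y^{\#}$. Then: 1) The equation $T^{\#}(A) = F$ has a solution $A \in X_T^{\#}$ if and only if $$\sup\nolimits_{Y^{\#}} \{\, T^{\#}(U) \mid U \in X_T^{\#},\ T^{\#}(U) \subseteq F \,\} \;=\; \inf\nolimits_{Y^{\#}} \{\, T^{\#}(V) \mid V \in X_T^{\#},\ F \subseteq T^{\#}(V) \,\}.$$ 2) This solution is unique whenever it exists. 3) When it exists, the unique solution $A \in X_T^{\#}$ is given by $$A \;=\; \sup\nolimits_{X_T^{\#}} \{\, U \in X_T^{\#} \mid T^{\#}(U) \subseteq F \,\} \;=\; \inf\nolimits_{X_T^{\#}} \{\, V \in X_T^{\#} \mid F \subseteq T^{\#}(V) \,\},$$ and both sets $\{\, U \in X_T^{\#} \mid T^{\#}(U) \subseteq F \,\}$ and $\{\, V \in X_T^{\#} \mid F \subseteq T^{\#}(V) \,\}$ are nonempty.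
   Context: Quotient and pull-back order: on $X$ define $u \approx_T v \iff T(u) = T(v)$, and let $X_T = X/\!\approx_T$. The mapping $T_\approx : X_T \to Y$ is defined by $T_\approx(U) = T(u)$ for any $u \in U$; it is injective. The partial order on $X_T$ is $U \leq_T V \iff T_\approx(U) \leq T_\approx(V)$. Order completion by cuts: for a nonvoid poset $(P,\leq)$ without minimum or maximum and $A \subseteq P$, let $A^u = \{x \in P \mid a \leq x \text{ for all } a \in A\}$ be the set of upper bounds and $A^l = \{x \in P \mid x \leq a \text{ for all } a \in A\}$ the set of lower bounds (so $\emptyset^u = \emptyset^l = P$), and $A^{ul} = (A^u)^l$. A subset $A \subseteq P$ is a cut if $A^{ul} = A$. $P^{\#}$ denotes the set of all cuts of $P$, partially ordered by inclusion $\subseteq$; it is order complete (a complete lattice; both $\emptyset$ and $P$ are cuts), with $\sup_{P^{\#}} \{A_i\}_{i\in I} = (\bigcup_{i} A_i)^{ul}$ and $\inf_{P^{\#}} \{A_i\}_{i \in I} = \bigcap_{i} A_i$ (with the infimum of the empty family equal to $P$). Extension of the mapping: for $A \in X_T^{\#}$ (a subset of $X_T$), $T^{\#}(A) = (T_\approx(A))^{ul} \in Y^{\#}$, where $T_\approx(A) = \{T_\approx(U) \mid U \in A\} \subseteq Y$ and the operation $(\cdot)^{ul}$ is taken in $Y$. *)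

theory Defs
  imports "HOL-Algebra.Complete_Lattice"
begin

definition fibre_rel :: "'a set \<Rightarrow> ('a \<Rightarrow> 'b) \<Rightarrow> ('a \<times> 'a) set" where
  "fibre_rel X T = {(u, v). u \<in> X \<and> v \<in> X \<and> T u = T v}"

text \<open>
  On a class \<open>U \<in> X // fibre_rel X T\<close> the mapping \<open>T\<close> is constant, so \<open>T ` U\<close> is a singleton
  and its element is the value of the induced mapping at \<open>U\<close>; see \<open>induced_map_eq\<close> below.
\<close>
definition induced_map :: "('a \<Rightarrow> 'b) \<Rightarrow> 'a set \<Rightarrow> 'b" where
  "induced_map T U = the_elem (T ` U)"

definition pullback_quotient :: "'a set \<Rightarrow> ('b, 'm) gorder_scheme \<Rightarrow> ('a \<Rightarrow> 'b) \<Rightarrow> 'a set gorder" where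
  "pullback_quotient X Y T =
     \<lparr> carrier = X // fibre_rel X T, eq = (=),
       le = (\<lambda>U V. induced_map T U \<sqsubseteq>\<^bsub>Y\<^esub> induced_map T V) \<rparr>"

definition cut_closure :: "('a, 'm) gorder_scheme \<Rightarrow> 'a set \<Rightarrow> 'a set" where
  "cut_closure P A = Lower P (Upper P A)"

definition cuts :: "('a, 'm) gorder_scheme \<Rightarrow> 'a set set" where
  "cuts P = {A. A \<subseteq> carrier P \<and> cut_closure P A = A}"

definition cut_completion :: "('a, 'm) gorder_scheme \<Rightarrow> 'a set gorder" where
  "cut_completion P = \<lparr> carrier = cuts P, eq = (=), le = (\<subseteq>) \<rparr>"

definition cut_extension ::
    "('b, 'm) gorder_scheme \<Rightarrow> ('a \<Rightarrow> 'b) \<Rightarrow> 'a set set \<Rightarrow> 'b set" where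
  "cut_extension Y T A = cut_closure Y (induced_map T ` A)"


lemma equiv_fibre_rel: "equiv X (fibre_rel X T)"
  by (rule equivI) (auto simp: fibre_rel_def refl_on_def sym_def trans_def)

lemma induced_map_eq:
  assumes "U \<in> X // fibre_rel X T" and "u \<in> U"
  shows "induced_map T U = T u"
proof -
  have "T ` U = {T u}"
    using assms by (auto simp: quotient_def fibre_rel_def)
  then show ?thesis by (simp add: induced_map_def)
qed

lemma inj_on_induced_map: "inj_on (induced_map T) (X // fibre_rel X T)"
proof (rule inj_onI)
  fix U V
  assume U: "U \<in> X // fibre_rel X T" and V: "V \<in> X // fibre_rel X T"
    and eq: "induced_map T U = induced_map T V"
  obtain u v where u: "u \<in> X" "U = fibre_rel X T `` {u}" and v: "v \<in> X" "V = fibre_rel X T `` {v}"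
    using U V by (auto simp: quotient_def)
  then have "u \<in> U" "v \<in> V" by (auto simp: fibre_rel_def)
  then have "T u = T v"
    using eq induced_map_eq[OF U] induced_map_eq[OF V] by simp
  then show "U = V"
    unfolding u v by (auto simp: fibre_rel_def u v)
qed

lemma induced_map_closed:
  assumes "T \<in> X \<rightarrow> carrier Y" and "U \<in> X // fibre_rel X T"
  shows "induced_map T U \<in> carrier Y"
proof -
  obtain u where "u \<in> X" "u \<in> U"
    using assms(2) by (auto simp: quotient_def fibre_rel_def)
  then show ?thesis
    using assms induced_map_eq[OF assms(2)] by auto
qed

lemma partial_order_pullback_quotient:
  assumes "partial_order Y" and T: "T \<in> X \<rightarrow> carrier Y"
  shows "partial_order (pullback_quotient X Y T)"
proof -
  interpret partial_order Y by fact
  note closed = induced_map_closed[OF T]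
  show ?thesis
    by standard
      (auto simp: pullback_quotient_def closed intro: le_trans
         dest: le_antisym inj_onD[OF inj_on_induced_map])
qed

lemma cut_closure_closed: "cut_closure P A \<subseteq> carrier P"
  by (simp add: cut_closure_def)

lemma cut_closure_in_cuts: "cut_closure P A \<in> cuts P"
  by (auto simp: cuts_def cut_closure_def Upper_def Lower_def)

lemma cut_closure_least:
  assumes "A \<subseteq> B" and "B \<in> cuts P"
  shows "cut_closure P A \<subseteq> B"
proof -
  have "cut_closure P A \<subseteq> cut_closure P B"
    using assms(1) by (auto simp: cut_closure_def Upper_def Lower_def)
  then show ?thesis using assms(2) by (simp add: cuts_def)
qed

lemma cut_closure_extensive: "A \<subseteq> carrier P \<Longrightarrow> A \<subseteq> cut_closure P A"
  by (auto simp: cut_closure_def Upper_def Lower_def)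

lemma cut_extension_in_cuts: "cut_extension Y T A \<in> cuts Y"
  by (simp add: cut_extension_def cut_closure_in_cuts)

lemma partial_order_cut_completion: "partial_order (cut_completion P)"
  by standard (auto simp: cut_completion_def)

lemma Inter_in_cuts:
  assumes "\<A> \<subseteq> cuts P"
  shows "carrier P \<inter> \<Inter>\<A> \<in> cuts P"
proof -
  let ?I = "carrier P \<inter> \<Inter>\<A>"
  have "cut_closure P ?I \<subseteq> A" if "A \<in> \<A>" for A
    using that assms by (intro cut_closure_least) auto
  then have "cut_closure P ?I \<subseteq> ?I"
    using cut_closure_closed[of P ?I] by blast
  then show ?thesis
    using cut_closure_extensive[of ?I P] by (auto simp: cuts_def)
qed

lemma least_cut_completion:
  assumes "\<A> \<subseteq> cuts P"
  shows "least (cut_completion P) (cut_closure P (\<Union>\<A>)) (Upper (cut_completion P) \<A>)"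
proof -
  have "\<Union>\<A> \<subseteq> carrier P" using assms by (auto simp: cuts_def)
  then have "\<Union>\<A> \<subseteq> cut_closure P (\<Union>\<A>)" by (rule cut_closure_extensive)
  then have "A \<subseteq> cut_closure P (\<Union>\<A>)" if "A \<in> \<A>" for A
    using that by blast
  moreover have "cut_closure P (\<Union>\<A>) \<subseteq> B" if "B \<in> cuts P" "\<forall>A\<in>\<A>. A \<subseteq> B" for B
    using that by (intro cut_closure_least) auto
  moreover have "Upper (cut_completion P) \<A> = {B \<in> cuts P. \<forall>A\<in>\<A>. A \<subseteq> B}"
    using assms by (auto simp: Upper_def cut_completion_def)
  ultimately show ?thesis
    using cut_closure_in_cuts[of P "\<Union>\<A>"]
    by (simp add: least_def cut_completion_def)
qed

lemma greatest_cut_completion: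
  assumes "\<A> \<subseteq> cuts P"
  shows "greatest (cut_completion P) (carrier P \<inter> \<Inter>\<A>) (Lower (cut_completion P) \<A>)"
proof -
  have "Lower (cut_completion P) \<A> = {B \<in> cuts P. \<forall>A\<in>\<A>. B \<subseteq> A}"
    using assms by (auto simp: Lower_def cut_completion_def)
  moreover have "B \<subseteq> carrier P \<inter> \<Inter>\<A>" if "B \<in> cuts P" "\<forall>A\<in>\<A>. B \<subseteq> A" for B
    using that unfolding cuts_def by blast
  ultimately show ?thesis
    using Inter_in_cuts[OF assms] by (simp add: greatest_def cut_completion_def) blast
qed

lemma complete_lattice_cut_completion: "complete_lattice (cut_completion P)"
proof (rule partial_order.complete_latticeI[OF partial_order_cut_completion])
  fix \<A> assume "\<A> \<subseteq> carrier (cut_completion P)"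
  then have "\<A> \<subseteq> cuts P" by (simp add: cut_completion_def)
  then show "\<exists>s. least (cut_completion P) s (Upper (cut_completion P) \<A>)"
    and "\<exists>i. greatest (cut_completion P) i (Lower (cut_completion P) \<A>)"
    using least_cut_completion greatest_cut_completion by blast+
qed

lemma sup_cut_completion:
  assumes "\<A> \<subseteq> cuts P"
  shows "\<Squnion>\<^bsub>cut_completion P\<^esub> \<A> = cut_closure P (\<Union>\<A>)"
  unfolding sup_def using least_cut_completion[OF assms]
  by (rule some_equality)
    (rule partial_order.least_unique[OF partial_order_cut_completion _ least_cut_completion[OF assms]])

text \<open>The intersection with the carrier only matters for \<open>\<A> = {}\<close>, where the infimum is all of \<open>P\<close>.\<close>
lemma inf_cut_completion:
  assumes "\<A> \<subseteq> cuts P"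
  shows "\<Sqinter>\<^bsub>cut_completion P\<^esub> \<A> = carrier P \<inter> \<Inter>\<A>"
  unfolding inf_def using greatest_cut_completion[OF assms]
  by (rule some_equality)
    (rule partial_order.greatest_unique[OF partial_order_cut_completion _ greatest_cut_completion[OF assms]])

end

theory Submission
  imports Defs
begin

text \<open>
  The extension \<open>T\<^sup>#\<close> is an order embedding of complete lattices, which gives uniqueness and the
  two formulas for the solution. If the supremum and the infimum in \<open>Y\<^sup>#\<close> agree, both are \<open>F\<close>;
  then with \<open>A\<close> the supremum of the subsolutions and \<open>B\<close> the infimum of the supersolutions,
  the embedding property yields \<open>A \<subseteq> B\<close>, so that \<open>F \<subseteq> T\<^sup># A \<subseteq> T\<^sup># B \<subseteq> F\<close>.
\<close>

lemma cut_closure_mono: "A \<subseteq> B \<Longrightarrow> cut_closure P A \<subseteq> cut_closure P B"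
  by (auto simp: cut_closure_def Upper_def Lower_def)

lemma cut_extension_mono: "A \<subseteq> B \<Longrightarrow> cut_extension Y T A \<subseteq> cut_extension Y T B"
  unfolding cut_extension_def by (intro cut_closure_mono image_mono)

text \<open>Upper bounds of \<open>B\<close> in the quotient are sent to upper bounds of its image
  in \<open>Y\<close>. The image of a point \<open>a\<close> of \<open>A\<close> lies in the closure
  of the image of \<open>B\<close>, hence below all of these. The quotient order is pulled back from
  \<open>Y\<close>, so \<open>a\<close> is below every upper bound of \<open>B\<close> and lies in
  the cut \<open>B\<close>.\<close>

lemma cut_extension_subset_iff:
  assumes T: "T \<in> X \<rightarrow> carrier Y"
    and A: "A \<in> cuts (pullback_quotient X Y T)" and B: "B \<in> cuts (pullback_quotient X Y T)"
  shows "cut_extension Y T A \<subseteq> cut_extension Y T B \<longleftrightarrow> A \<subseteq> B"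
proof
  let ?P = "pullback_quotient X Y T"
  have carr: "carrier ?P = X // fibre_rel X T" by (simp add: pullback_quotient_def)
  have le: "le ?P U V \<longleftrightarrow> le Y (induced_map T U) (induced_map T V)" for U V
    by (simp add: pullback_quotient_def)
  have closed: "induced_map T U \<in> carrier Y" if "U \<in> carrier ?P" for U
    using induced_map_closed[OF T] that by (simp add: carr)
  have AP: "A \<subseteq> carrier ?P" and BP: "B \<subseteq> carrier ?P"
    using A B by (auto simp: cuts_def)
  assume sub: "cut_extension Y T A \<subseteq> cut_extension Y T B"
  have "A \<subseteq> cut_closure ?P B"
  proof
    fix a assume a: "a \<in> A"
    have "induced_map T ` A \<subseteq> cut_extension Y T A"
      unfolding cut_extension_def using closed AP by (intro cut_closure_extensive) auto
    with a sub have a_cl: "induced_map T a \<in> cut_closure Y (induced_map T ` B)"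
      by (auto simp: cut_extension_def)
    have "le ?P a x" if x: "x \<in> Upper ?P B" for x
    proof -
      have "induced_map T x \<in> Upper Y (induced_map T ` B)"
        using x BP closed le by (auto simp: Upper_def)
      then show ?thesis
        using a_cl closed x unfolding le cut_closure_def Lower_def Upper_def by auto
    qed
    then show "a \<in> cut_closure ?P B"
      using a AP by (auto simp: cut_closure_def Lower_def)
  qed
  with B show "A \<subseteq> B" by (simp add: cuts_def)
qed (rule cut_extension_mono)

theorem theorem7p1:
  fixes X :: "'a set" and Y :: "('b, 'm) gorder_scheme" and T :: "'a \<Rightarrow> 'b" and F :: "'b set"
  defines "XT \<equiv> pullback_quotient X Y T"
  defines "XTc \<equiv> cut_completion XT" and "Yc \<equiv> cut_completion Y"
  defines "Tc \<equiv> cut_extension Y T"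
  assumes "X \<noteq> {}"
    and "partial_order Y" and "carrier Y \<noteq> {}"
    and "T \<in> X \<rightarrow> carrier Y"
    and "\<nexists>m. least Y m (carrier Y)" and "\<nexists>m. greatest Y m (carrier Y)"
    and "\<nexists>m. least XT m (carrier XT)" and "\<nexists>m. greatest XT m (carrier XT)"
    and "F \<in> carrier Yc"
  shows "((\<exists>A \<in> carrier XTc. Tc A = F) \<longleftrightarrow>
            \<Squnion>\<^bsub>Yc\<^esub> {Tc U | U. U \<in> carrier XTc \<and> Tc U \<subseteq> F} =
            \<Sqinter>\<^bsub>Yc\<^esub> {Tc V | V. V \<in> carrier XTc \<and> F \<subseteq> Tc V})
    \<and> (\<forall>A \<in> carrier XTc. \<forall>B \<in> carrier XTc. Tc A = F \<longrightarrow> Tc B = F \<longrightarrow> A = B)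
    \<and> (\<forall>A \<in> carrier XTc. Tc A = F \<longrightarrow>
           A = \<Squnion>\<^bsub>XTc\<^esub> {U \<in> carrier XTc. Tc U \<subseteq> F} \<and>
           A = \<Sqinter>\<^bsub>XTc\<^esub> {V \<in> carrier XTc. F \<subseteq> Tc V} \<and>
           {U \<in> carrier XTc. Tc U \<subseteq> F} \<noteq> {} \<and>
           {V \<in> carrier XTc. F \<subseteq> Tc V} \<noteq> {})"
proof -
  have carr: "carrier XTc = cuts XT" "carrier Yc = cuts Y"
    by (simp_all add: XTc_def Yc_def cut_completion_def)
  have F: "F \<in> cuts Y" using assms(13) by (simp add: carr)
  have cut: "Tc A \<in> cuts Y" for A by (simp add: Tc_def cut_extension_in_cuts)
  have mono: "A \<subseteq> B \<Longrightarrow> Tc A \<subseteq> Tc B" for A B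
    by (simp add: Tc_def cut_extension_mono)
  have emb: "Tc A \<subseteq> Tc B \<longleftrightarrow> A \<subseteq> B" if "A \<in> cuts XT" "B \<in> cuts XT" for A B
    using cut_extension_subset_iff[OF \<open>T \<in> X \<rightarrow> carrier Y\<close>] that
    unfolding Tc_def XT_def by blast
  define L where "L = {U \<in> cuts XT. Tc U \<subseteq> F}"
  define R where "R = {V \<in> cuts XT. F \<subseteq> Tc V}"
  have L: "L \<subseteq> cuts XT" "Tc ` L \<subseteq> cuts Y" and R: "R \<subseteq> cuts XT" "Tc ` R \<subseteq> cuts Y"
    using cut by (auto simp: L_def R_def)
  have supY: "\<Squnion>\<^bsub>Yc\<^esub> (Tc ` L) = cut_closure Y (\<Union>(Tc ` L))"
    and supX: "\<Squnion>\<^bsub>XTc\<^esub> L = cut_closure XT (\<Union>L)"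
    and infY: "\<Sqinter>\<^bsub>Yc\<^esub> (Tc ` R) = carrier Y \<inter> \<Inter>(Tc ` R)"
    and infX: "\<Sqinter>\<^bsub>XTc\<^esub> R = carrier XT \<inter> \<Inter>R"
    unfolding XTc_def Yc_def
    by (intro sup_cut_completion inf_cut_completion L R)+
  \<comment> \<open>For every cut \<open>F\<close>, the supremum over \<open>L\<close> lies in
    \<open>F\<close> and \<open>F\<close> lies in the infimum over \<open>R\<close>. Equality of
    these two bounds therefore forces both to be \<open>F\<close>.\<close>
  have sup_le: "cut_closure Y (\<Union>(Tc ` L)) \<subseteq> F"
    using F by (intro cut_closure_least) (auto simp: L_def)
  have le_inf: "F \<subseteq> carrier Y \<inter> \<Inter>(Tc ` R)"
    using F by (auto simp: R_def cuts_def)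

  have uniq: "A = B" if "A \<in> cuts XT" "B \<in> cuts XT" "Tc A = F" "Tc B = F" for A B
    using emb that by blast

  have sol: "cut_closure Y (\<Union>(Tc ` L)) = F \<and> carrier Y \<inter> \<Inter>(Tc ` R) = F \<and>
      A = cut_closure XT (\<Union>L) \<and> A = carrier XT \<inter> \<Inter>R \<and> A \<in> L \<and> A \<in> R"
    if A: "A \<in> cuts XT" "Tc A = F" for A
  proof -
    have AL: "A \<in> L" and AR: "A \<in> R" using A by (auto simp: L_def R_def)
    have L_le: "U \<subseteq> A" if "U \<in> L" for U using that A emb by (auto simp: L_def)
    have R_ge: "A \<subseteq> V" if "V \<in> R" for V using that A emb by (auto simp: R_def)
    \<comment> \<open>The solution is a member of both families: the largest element of
      \<open>L\<close> and the smallest of \<open>R\<close>. The same holds for its image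
      \<open>F\<close> among the images.\<close>
    have "\<Union>L = A" and "\<Inter>R = A"
      using AL AR L_le R_ge by blast+
    moreover have "\<Union>(Tc ` L) = F" and "\<Inter>(Tc ` R) = F"
      using A AL AR unfolding L_def R_def by blast+
    \<comment> \<open>\<open>A\<close> and \<open>F\<close> are cuts, so the closures fix them, and
      intersecting with the carriers changes nothing.\<close>
    ultimately show ?thesis
      using A F AL AR unfolding cuts_def by simp blast
  qed

  have ex: "\<exists>A \<in> cuts XT. Tc A = F"
    if eq: "cut_closure Y (\<Union>(Tc ` L)) = carrier Y \<inter> \<Inter>(Tc ` R)"
  proof -
    let ?A = "cut_closure XT (\<Union>L)" and ?B = "carrier XT \<inter> \<Inter>R"
    have A: "?A \<in> cuts XT" and B: "?B \<in> cuts XT"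
      using cut_closure_in_cuts Inter_in_cuts R by blast+
    have UA: "U \<subseteq> ?A" if "U \<in> L" for U
    proof -
      have "\<Union>L \<subseteq> ?A" using L by (intro cut_closure_extensive) (auto simp: cuts_def)
      with that show ?thesis by blast
    qed
    \<comment> \<open>Here the embedding is reflected: \<open>Tc U\<close> \<subseteq>
      \<open>F\<close> \<subseteq> \<open>Tc V\<close> gives an inclusion between the
      arguments.\<close>
    have "U \<subseteq> V" if "U \<in> L" "V \<in> R" for U V
      using that emb[of U V] by (auto simp: L_def R_def)
    \<comment> \<open>This bound covers \<open>R = {}\<close>, where \<open>?B\<close> is the whole
      carrier.\<close>
    moreover have "U \<subseteq> carrier XT" if "U \<in> L" for U
      using that by (simp add: L_def cuts_def)
    ultimately have "\<Union>L \<subseteq> ?B" by blast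
    then have AB: "?A \<subseteq> ?B" using B by (rule cut_closure_least)
    have sup_eq: "cut_closure Y (\<Union>(Tc ` L)) = F"
      using sup_le le_inf eq by (metis subset_antisym)
    \<comment> \<open>\<open>Tc ?A\<close> is a cut containing every \<open>Tc U\<close> with
      \<open>U\<close> in \<open>L\<close>, so it contains their supremum, which is
      \<open>F\<close>.\<close>
    have "\<Union>(Tc ` L) \<subseteq> Tc ?A" by (intro UN_least mono UA)
    then have FA: "F \<subseteq> Tc ?A"
      unfolding sup_eq[symmetric] using cut by (rule cut_closure_least)
    \<comment> \<open>Dually, \<open>Tc ?B\<close> is a lower bound of the images of
      \<open>R\<close>, so it lies in their infimum, again \<open>F\<close>. Thus
      \<open>Tc ?A\<close> is squeezed between \<open>F\<close> and \<open>Tc ?B\<close>.\<close>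
    have "Tc ?B \<subseteq> Tc V" if "V \<in> R" for V using that by (intro mono) blast
    moreover have "Tc ?B \<subseteq> carrier Y" using cut[of ?B] by (simp add: cuts_def)
    ultimately have "Tc ?B \<subseteq> carrier Y \<inter> \<Inter>(Tc ` R)" by (intro Int_greatest INF_greatest)
    then have "Tc ?A \<subseteq> F"
      using mono[OF AB] eq sup_eq by (metis subset_trans)
    with FA A show ?thesis by (intro bexI[of _ ?A] subset_antisym)
  qed

  have sets: "{Tc U | U. U \<in> carrier XTc \<and> Tc U \<subseteq> F} = Tc ` L"
    "{Tc V | V. V \<in> carrier XTc \<and> F \<subseteq> Tc V} = Tc ` R"
    "{U \<in> carrier XTc. Tc U \<subseteq> F} = L" "{V \<in> carrier XTc. F \<subseteq> Tc V} = R"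
    by (auto simp: L_def R_def carr)
  have "(\<exists>A \<in> cuts XT. Tc A = F) \<longleftrightarrow>
      cut_closure Y (\<Union>(Tc ` L)) = carrier Y \<inter> \<Inter>(Tc ` R)"
    using ex sol by metis
  moreover have "A = cut_closure XT (\<Union>L) \<and> A = carrier XT \<inter> \<Inter>R \<and> L \<noteq> {} \<and> R \<noteq> {}"
    if "A \<in> cuts XT" "Tc A = F" for A
    using sol[OF that] by blast
  ultimately show ?thesis
    unfolding sets unfolding supX supY infX infY carr using uniq by (intro conjI ballI impI) simp_all
qed

end
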